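(* Let $1\le d<\infty$, $0\le n<\infty$, let $F=\mathbb{Z}_{i_1}\times\cdots\times\mathbb{Z}_{i_n}$ (a finite Abelian group, trivial if $n=0$) and $G=F\times\mathbb{Z}^d$. Let $A$ be the unitary operator on $\ell^2(G)=\ell^2(F)\otimes\ell^2(\mathbb{Z}^d)$ of a scalar quantum walk on a Cayley graph of $G$ (with respect to an arbitrary finite generating set, not necessarily symmetric). Then $A$ splits into a direct sum of phase factors times shift operators over $\mathbb{Z}^d$: with $N=i_1 i_2\cdots i_n=|F|$, there exist an orthonormal basis $(v_j)_{j=1}^{N}$ of $\ell^2(F)$, vectors $\mathbf{h}_1,\dots,\mathbf{h}_N\in\mathbb{Z}^d$ and real numbers $\theta_1,\dots,\theta_N$ such that $$A=\sum_{j=1}^{N}|v_j\rangle\langle v_j|\otimes e^{-i\theta_j}T_{\mathbf{h}_j},$$ that is, $A=\bigoplus_{j=1}^N e^{-i\theta_j}T_{\mathbf{h}_j}$ with respect to $\ell^2(G)=\bigoplus_{j=1}^N \mathbb{C}v_j\otimes\ell^2(\mathbb{Z}^d)$. In particular, the dispersion relations of $A$ are linear in the wave-vector: for every wave-vector $\mathbf{k}$ the eigenvalues of the Fourier symbol $A_{\mathbf{k}}$, which acts on $\ell^2(F)\cong\mathbb{C}^N$, are $e^{-i(\mathbf{k}\cdot\mathbf{h}_j+\theta_j)}$, $j=1,\dots,N$.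
   Context: For a discrete group $G$, the right regular representation $T$ on $\ell^2(G)$ is $T_g|x\rangle=|xg^{-1}\rangle$. For $\mathbf{h}\in\mathbb{Z}^d$, $T_{\mathbf{h}}$ denotes the shift operator on $\ell^2(\mathbb{Z}^d)$ given by $T_{\mathbf{h}}|\mathbf{x}\rangle=|\mathbf{x}-\mathbf{h}\rangle$ (the case $\mathbf h=0$ is allowed). A scalar quantum walk (a walk with one-dimensional coin) on the Cayley graph $\Gamma(G,S_+)$, where $S_+\subseteq G$ is a finite generating set of $G$ (every element of $G$ is a product of elements of $S_+$ and their inverses; $S_+$ need not be symmetric and may contain the identity), is a unitary operator on $\ell^2(G)$ of the form $A=\sum_{h\in S_+}z_hT_h$ with all $z_h\in\mathbb{C}\setminus\{0\}$. Fourier symbol: for $G=F\times\mathbb{Z}^d$, writing $T_{(f,\mathbf{x})}=T_f\otimes T_{\mathbf{x}}$ and $A=\sum_{(f,\mathbf{x})\in S_+}z_{(f,\mathbf{x})}\,T_f\otimes T_{\mathbf{x}}$, one sets $A_{\mathbf{k}}=\sum_{(f,\mathbf{x})\in S_+}z_{(f,\mathbf{x})}e^{-i\mathbf{k}\cdot\mathbf{x}}\,T_f$, a unitary operator on $\ell^2(F)$ for each wave-vector $\mathbf{k}\in\mathbb{R}^d$ (modulo $2\pi\mathbb{Z}^d$). The dispersion relations are the phases of the eigenvalues of $A_{\mathbf{k}}$ as functions of $\mathbf{k}$. *)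

theory Defs
  imports "HOL-Analysis.Infinite_Sum" "HOL-Algebra.Product_Groups"
begin

text \<open>
  A vector of the Hilbert space of square-summable functions on a set \<open>X\<close> is represented by a
  function on the whole type that vanishes outside \<open>X\<close>, so that equality of vectors is equality of
  functions.  An operator is a map on functions; only its values on \<open>ell2 X\<close> matter.
\<close>

definition ell2 :: "'a set \<Rightarrow> ('a \<Rightarrow> complex) set" where
  "ell2 X = {\<psi>. (\<forall>x. x \<notin> X \<longrightarrow> \<psi> x = 0) \<and> (\<lambda>x. (cmod (\<psi> x))\<^sup>2) summable_on X}"

definition ell2_inner :: "'a set \<Rightarrow> ('a \<Rightarrow> complex) \<Rightarrow> ('a \<Rightarrow> complex) \<Rightarrow> complex" where
  "ell2_inner X \<phi> \<psi> = infsum (\<lambda>x. cnj (\<phi> x) * \<psi> x) X"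

definition ket :: "'a \<Rightarrow> 'a \<Rightarrow> complex" where
  "ket x = (\<lambda>y. if y = x then 1 else 0)"

definition ketbra ::
  "'a set \<Rightarrow> ('a \<Rightarrow> complex) \<Rightarrow> ('a \<Rightarrow> complex) \<Rightarrow> ('a \<Rightarrow> complex) \<Rightarrow> ('a \<Rightarrow> complex)" where
  "ketbra X v w = (\<lambda>\<psi> x. ell2_inner X w \<psi> * v x)"

definition linear_on_ell2 :: "'a set \<Rightarrow> (('a \<Rightarrow> complex) \<Rightarrow> ('a \<Rightarrow> complex)) \<Rightarrow> bool" where
  "linear_on_ell2 X U \<longleftrightarrow>
     (\<forall>\<phi>\<in>ell2 X. \<forall>\<psi>\<in>ell2 X. \<forall>a b.
        U (\<lambda>x. a * \<phi> x + b * \<psi> x) = (\<lambda>x. a * U \<phi> x + b * U \<psi> x))"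

definition unitary_on_ell2 :: "'a set \<Rightarrow> (('a \<Rightarrow> complex) \<Rightarrow> ('a \<Rightarrow> complex)) \<Rightarrow> bool" where
  "unitary_on_ell2 X U \<longleftrightarrow>
     linear_on_ell2 X U \<and> U ` ell2 X = ell2 X \<and>
     (\<forall>\<phi>\<in>ell2 X. \<forall>\<psi>\<in>ell2 X. ell2_inner X (U \<phi>) (U \<psi>) = ell2_inner X \<phi> \<psi>)"

definition eigenvalue_on_ell2 ::
  "'a set \<Rightarrow> (('a \<Rightarrow> complex) \<Rightarrow> ('a \<Rightarrow> complex)) \<Rightarrow> complex \<Rightarrow> bool" where
  "eigenvalue_on_ell2 X U \<mu> \<longleftrightarrow>
     (\<exists>\<psi>\<in>ell2 X. \<psi> \<noteq> (\<lambda>x. 0) \<and> U \<psi> = (\<lambda>x. \<mu> * \<psi> x))"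

text \<open>
  The next two notions are only meant for finite index sets \<open>J\<close>, where no closure of the linear
  span is needed.
\<close>

definition orthonormal_basis :: "'a set \<Rightarrow> 'j set \<Rightarrow> ('j \<Rightarrow> 'a \<Rightarrow> complex) \<Rightarrow> bool" where
  "orthonormal_basis X J v \<longleftrightarrow>
     (\<forall>j\<in>J. v j \<in> ell2 X) \<and>
     (\<forall>j\<in>J. \<forall>k\<in>J. ell2_inner X (v j) (v k) = (if j = k then 1 else 0)) \<and>
     (\<forall>\<psi>\<in>ell2 X. \<exists>c. \<psi> = (\<lambda>x. \<Sum>j\<in>J. c j * v j x))"

definition orthogonal_direct_sum :: "'a set \<Rightarrow> 'j set \<Rightarrow> ('j \<Rightarrow> ('a \<Rightarrow> complex) set) \<Rightarrow> bool" where
  "orthogonal_direct_sum X J W \<longleftrightarrow>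
     (\<forall>j\<in>J. W j \<subseteq> ell2 X \<and> (\<lambda>x. 0) \<in> W j \<and>
        (\<forall>\<phi>\<in>W j. \<forall>\<psi>\<in>W j. \<forall>a b. (\<lambda>x. a * \<phi> x + b * \<psi> x) \<in> W j)) \<and>
     (\<forall>j\<in>J. \<forall>k\<in>J. j \<noteq> k \<longrightarrow> (\<forall>\<phi>\<in>W j. \<forall>\<psi>\<in>W k. ell2_inner X \<phi> \<psi> = 0)) \<and>
     (\<forall>\<psi>\<in>ell2 X. \<exists>\<phi>. (\<forall>j\<in>J. \<phi> j \<in> W j) \<and> \<psi> = (\<lambda>x. \<Sum>j\<in>J. \<phi> j x))"

definition tensor :: "('a \<Rightarrow> complex) \<Rightarrow> ('b \<Rightarrow> complex) \<Rightarrow> ('a \<times> 'b \<Rightarrow> complex)" where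
  "tensor \<phi> \<psi> = (\<lambda>(f, x). \<phi> f * \<psi> x)"

text \<open>
  \<open>tensor_op X P B\<close> is the operator \<open>P \<otimes> B\<close> when the first factor lives on a finite set \<open>X\<close>: a
  vector \<open>\<psi>\<close> is the sum over \<open>g\<close> in \<open>X\<close> of \<open>|g\<rangle> \<otimes> \<psi>(g, \<cdot>)\<close>, and \<open>P\<close>, \<open>B\<close> act on the two legs.
\<close>

definition tensor_op ::
  "'a set \<Rightarrow> (('a \<Rightarrow> complex) \<Rightarrow> ('a \<Rightarrow> complex)) \<Rightarrow> (('b \<Rightarrow> complex) \<Rightarrow> ('b \<Rightarrow> complex)) \<Rightarrow>
     ('a \<times> 'b \<Rightarrow> complex) \<Rightarrow> ('a \<times> 'b \<Rightarrow> complex)" where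
  "tensor_op X P B \<psi> = (\<lambda>(f, x). \<Sum>g\<in>X. P (ket g) f * B (\<lambda>y. \<psi> (g, y)) x)"

text \<open>
  The operator sending \<open>|x\<rangle>\<close> to \<open>|x g\<inverse>\<rangle>\<close> acts on wave functions by \<open>(T\<^sub>g \<psi>)(y) = \<psi>(y g)\<close>; see
  \<open>right_regular_ket\<close> below.
\<close>

definition right_regular ::
  "('g, 'm) monoid_scheme \<Rightarrow> 'g \<Rightarrow> ('g \<Rightarrow> complex) \<Rightarrow> ('g \<Rightarrow> complex)" where
  "right_regular G g \<psi> = (\<lambda>y. if y \<in> carrier G then \<psi> (y \<otimes>\<^bsub>G\<^esub> g) else 0)"

definition scalar_quantum_walk ::
  "('g, 'm) monoid_scheme \<Rightarrow> 'g set \<Rightarrow> ('g \<Rightarrow> complex) \<Rightarrow>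
     (('g \<Rightarrow> complex) \<Rightarrow> ('g \<Rightarrow> complex)) \<Rightarrow> bool" where
  "scalar_quantum_walk G S z A \<longleftrightarrow>
     finite S \<and> S \<subseteq> carrier G \<and> generate G S = carrier G \<and>
     (\<forall>h\<in>S. z h \<noteq> 0) \<and>
     (\<forall>\<psi>\<in>ell2 (carrier G). A \<psi> = (\<lambda>x. \<Sum>h\<in>S. z h * right_regular G h \<psi> x)) \<and>
     unitary_on_ell2 (carrier G) A"

text \<open>
  \<open>integer_mod_group 0\<close> is the infinite cyclic group, so \<open>cyclic_product n i\<close> is the intended
  finite group only if all the \<open>i j\<close> are positive.
\<close>

definition cyclic_product :: "nat \<Rightarrow> (nat \<Rightarrow> nat) \<Rightarrow> (nat \<Rightarrow> int) monoid" where
  "cyclic_product n i = product_group {1..n} (\<lambda>j. integer_mod_group (i j))"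

definition int_lattice :: "nat \<Rightarrow> (nat \<Rightarrow> int) monoid" where
  "int_lattice d = product_group {1..d} (\<lambda>_. integer_group)"

definition wave_dot :: "nat \<Rightarrow> (nat \<Rightarrow> real) \<Rightarrow> (nat \<Rightarrow> int) \<Rightarrow> real" where
  "wave_dot d k x = (\<Sum>m=1..d. k m * of_int (x m))"

definition fourier_symbol ::
  "('f, 'm) monoid_scheme \<Rightarrow> nat \<Rightarrow> ('f \<times> (nat \<Rightarrow> int)) set \<Rightarrow> ('f \<times> (nat \<Rightarrow> int) \<Rightarrow> complex) \<Rightarrow>
     (nat \<Rightarrow> real) \<Rightarrow> ('f \<Rightarrow> complex) \<Rightarrow> ('f \<Rightarrow> complex)" where
  "fourier_symbol F d S z k \<psi> =
     (\<lambda>g. \<Sum>(f, x)\<in>S. z (f, x) * exp (- (\<i> * of_real (wave_dot d k x))) * right_regular F f \<psi> g)"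

lemma right_regular_ket:
  assumes "group G" "g \<in> carrier G" "x \<in> carrier G"
  shows "right_regular G g (ket x) = ket (x \<otimes>\<^bsub>G\<^esub> inv\<^bsub>G\<^esub> g)"
proof -
  interpret group G by fact
  have "y \<otimes>\<^bsub>G\<^esub> g = x \<longleftrightarrow> y = x \<otimes>\<^bsub>G\<^esub> inv\<^bsub>G\<^esub> g" if "y \<in> carrier G" for y
    using that assms by (metis inv_solve_right')
  moreover have "x \<otimes>\<^bsub>G\<^esub> inv\<^bsub>G\<^esub> g \<in> carrier G" using assms by simp
  ultimately show ?thesis
    by (auto simp: right_regular_def ket_def fun_eq_iff)
qed

lemma right_regular_int_lattice_ket:
  assumes "h \<in> carrier (int_lattice d)" "x \<in> carrier (int_lattice d)"
  shows "right_regular (int_lattice d) h (ket x) = ket (\<lambda>m\<in>{1..d}. x m - h m)"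
proof -
  have grp: "group (int_lattice d)" by (simp add: int_lattice_def)
  have "inv\<^bsub>int_lattice d\<^esub> h = (\<lambda>m\<in>{1..d}. - h m)"
    using assms by (simp add: int_lattice_def)
  then have "x \<otimes>\<^bsub>int_lattice d\<^esub> inv\<^bsub>int_lattice d\<^esub> h = (\<lambda>m\<in>{1..d}. x m - h m)"
    by (auto simp: int_lattice_def fun_eq_iff)
  then show ?thesis using right_regular_ket[OF grp assms] by simp
qed

lemma tensor_op_right_regular:
  assumes "group F" "finite (carrier F)" "f \<in> carrier F"
  shows "right_regular (F \<times>\<times> H) (f, x) \<psi> =
         tensor_op (carrier F) (right_regular F f) (right_regular H x) \<psi>"
proof -
  interpret F: group F by fact
  have *: "(\<Sum>g\<in>carrier F. right_regular F f (ket g) a * right_regular H x (\<lambda>y. \<psi> (g, y)) b) =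
        right_regular (F \<times>\<times> H) (f, x) \<psi> (a, b)" for a b
  proof (cases "a \<in> carrier F")
    case True
    then have "(\<Sum>g\<in>carrier F. right_regular F f (ket g) a * right_regular H x (\<lambda>y. \<psi> (g, y)) b) =
        (\<Sum>g\<in>carrier F. if a \<otimes>\<^bsub>F\<^esub> f = g then right_regular H x (\<lambda>y. \<psi> (g, y)) b else 0)"
      by (intro sum.cong) (auto simp: right_regular_def ket_def)
    also have "\<dots> = right_regular H x (\<lambda>y. \<psi> (a \<otimes>\<^bsub>F\<^esub> f, y)) b"
      using True assms by simp
    finally show ?thesis using True by (simp add: right_regular_def)
  qed (simp add: right_regular_def)
  show ?thesis by (auto simp: tensor_op_def fun_eq_iff *)
qed

lemma tensor_op_ketbra_tensor:
  assumes "finite X" and B: "\<And>c. B (\<lambda>y. c * \<psi> y) = (\<lambda>y. c * B \<psi> y)"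
  shows "tensor_op X (ketbra X v w) B (tensor \<phi> \<psi>) = tensor (ketbra X v w \<phi>) (B \<psi>)"
proof -
  have *: "ell2_inner X w (ket g) = cnj (w g)" if "g \<in> X" for g
  proof -
    have "ell2_inner X w (ket g) = (\<Sum>x\<in>X. if g = x then cnj (w x) else 0)"
      unfolding ell2_inner_def infsum_finite[OF \<open>finite X\<close>]
      by (intro sum.cong) (auto simp: ket_def)
    then show ?thesis using that assms by simp
  qed
  have "tensor_op X (ketbra X v w) B (tensor \<phi> \<psi>) (a, b) = tensor (ketbra X v w \<phi>) (B \<psi>) (a, b)"
    for a b
  proof -
    have "tensor_op X (ketbra X v w) B (tensor \<phi> \<psi>) (a, b) =
        (\<Sum>g\<in>X. cnj (w g) * \<phi> g * (v a * B \<psi> b))"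
      by (simp add: tensor_op_def tensor_def ketbra_def B * algebra_simps)
    also have "\<dots> = ell2_inner X w \<phi> * (v a * B \<psi> b)"
      using \<open>finite X\<close> by (simp add: ell2_inner_def sum_distrib_right)
    finally show ?thesis by (simp add: tensor_def ketbra_def)
  qed
  then show ?thesis by auto
qed

end

(*
  The normalised characters v of F are common eigenvectors of its regular representation, so A maps
  v \<otimes> \<phi> to v \<otimes> B \<phi> for some finite combination B = \<Sum>x. w x T_x of lattice shifts, which is again
  an isometry.  Let (a, b) be a pair of points of the support of w at maximal distance.  The
  difference a - b occurs only once among the differences of support points, so the inner product of
  B |a> and B |b> is the single term cnj (w a) * w b, which is nonzero.  Hence a = b, the support is
  one point, and B is a phase times a shift.
*)

theory Submission
  imports Defs
begin

section \<open>Square-summable functions\<close>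

text \<open>The total space is a finite disjoint union of fibres, so summability on each fibre
  suffices, with no uniform bound.\<close>

lemma summable_on_Sigma_finite:
  fixes f :: "'a \<times> 'b \<Rightarrow> 'c::topological_comm_monoid_add"
  assumes "finite X" and "\<And>a. a \<in> X \<Longrightarrow> (\<lambda>y. f (a, y)) summable_on Y a"
  shows "f summable_on Sigma X Y"
proof -
  have "f summable_on (\<Union>a\<in>X. Pair a ` Y a)"
  proof (rule summable_on_finite_union_disjoint)
    fix a assume "a \<in> X"
    then show "f summable_on (Pair a ` Y a)"
      using assms(2) by (subst summable_on_reindex) (auto simp: inj_on_def o_def)
  qed (use \<open>finite X\<close> in auto)
  moreover have "(\<Union>a\<in>X. Pair a ` Y a) = Sigma X Y" by auto
  ultimately show ?thesis by simp
qed

text \<open>By 2ab <= a^2 + b^2 the products are absolutely summable, so \<open>ell2_inner\<close>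
  is a genuine sum and not the default value 0 of \<open>infsum\<close>.\<close>

lemma ell2_inner_summable:
  assumes "\<phi> \<in> ell2 X" "\<psi> \<in> ell2 X"
  shows "(\<lambda>x. cnj (\<phi> x) * \<psi> x) summable_on X"
proof (rule abs_summable_summable, rule summable_on_comparison_test)
  show "(\<lambda>x. (cmod (\<phi> x))\<^sup>2 + (cmod (\<psi> x))\<^sup>2) summable_on X"
    using assms by (intro summable_on_add) (auto simp: ell2_def)
  show "norm (cnj (\<phi> x) * \<psi> x) \<le> (cmod (\<phi> x))\<^sup>2 + (cmod (\<psi> x))\<^sup>2" for x
  proof -
    have "2 * (cmod (\<phi> x) * cmod (\<psi> x)) \<le> (cmod (\<phi> x))\<^sup>2 + (cmod (\<psi> x))\<^sup>2"
      using sum_squares_bound[of "cmod (\<phi> x)" "cmod (\<psi> x)"] by simp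
    moreover have "0 \<le> cmod (\<phi> x) * cmod (\<psi> x)" by simp
    ultimately show ?thesis unfolding norm_mult complex_mod_cnj by linarith
  qed
qed simp

lemma ell2_zero: "(\<lambda>x. 0) \<in> ell2 X"
  by (simp add: ell2_def)

lemma ell2_scale: "\<phi> \<in> ell2 X \<Longrightarrow> (\<lambda>x. a * \<phi> x) \<in> ell2 X"
  by (auto simp: ell2_def norm_mult power_mult_distrib intro: summable_on_cmult_right)

lemma ell2_add:
  assumes "\<phi> \<in> ell2 X" "\<psi> \<in> ell2 X"
  shows "(\<lambda>x. \<phi> x + \<psi> x) \<in> ell2 X"
proof -
  have "(\<lambda>x. (cmod (\<phi> x + \<psi> x))\<^sup>2) summable_on X"
  proof (rule summable_on_comparison_test)
    show "(\<lambda>x. 2 * (cmod (\<phi> x))\<^sup>2 + 2 * (cmod (\<psi> x))\<^sup>2) summable_on X"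
      using assms by (intro summable_on_add summable_on_cmult_right) (auto simp: ell2_def)
    show "(cmod (\<phi> x + \<psi> x))\<^sup>2 \<le> 2 * (cmod (\<phi> x))\<^sup>2 + 2 * (cmod (\<psi> x))\<^sup>2" for x
    proof -
      have "(cmod (\<phi> x + \<psi> x))\<^sup>2 \<le> (cmod (\<phi> x) + cmod (\<psi> x))\<^sup>2"
        by (intro power_mono norm_triangle_ineq) auto
      also have "\<dots> \<le> 2 * (cmod (\<phi> x))\<^sup>2 + 2 * (cmod (\<psi> x))\<^sup>2"
        using sum_squares_bound[of "cmod (\<phi> x)" "cmod (\<psi> x)"] by (simp add: power2_sum)
      finally show ?thesis .
    qed
  qed simp
  then show ?thesis using assms by (auto simp: ell2_def)
qed

lemma ell2_sum: "(\<And>j. j \<in> J \<Longrightarrow> \<phi> j \<in> ell2 X) \<Longrightarrow> (\<lambda>x. \<Sum>j\<in>J. \<phi> j x) \<in> ell2 X"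
  by (induction J rule: infinite_finite_induct) (auto simp: ell2_zero intro: ell2_add)

lemma ell2_finite: "finite X \<Longrightarrow> \<phi> \<in> ell2 X \<longleftrightarrow> (\<forall>x. x \<notin> X \<longrightarrow> \<phi> x = 0)"
  by (simp add: ell2_def)

lemma ell2_outside: "\<phi> \<in> ell2 X \<Longrightarrow> x \<notin> X \<Longrightarrow> \<phi> x = 0"
  by (simp add: ell2_def)

lemma ell2_ket:
  assumes "x \<in> X" shows "ket x \<in> ell2 X"
proof -
  have "((\<lambda>y. (cmod (ket x y))\<^sup>2) has_sum 1) X"
    by (rule has_sum_finite_neutralI[where B = "{x}"]) (use assms in \<open>auto simp: ket_def\<close>)
  then show ?thesis using assms by (auto simp: ell2_def ket_def summable_on_def)
qed

lemma ell2_inner_ket: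
  assumes "x \<in> X" shows "ell2_inner X (ket x) \<phi> = \<phi> x"
  unfolding ell2_inner_def
  by (rule infsumI, rule has_sum_finite_neutralI[where B = "{x}"]) (use assms in \<open>auto simp: ket_def\<close>)

lemma ell2_slice:
  assumes "\<psi> \<in> ell2 (X \<times> Y)" shows "(\<lambda>y. \<psi> (g, y)) \<in> ell2 Y"
proof (cases "g \<in> X")
  case True
  have "(\<lambda>p. (cmod (\<psi> p))\<^sup>2) summable_on Pair g ` Y"
    using assms True by (auto simp: ell2_def intro: summable_on_subset_banach)
  then have "(\<lambda>y. (cmod (\<psi> (g, y)))\<^sup>2) summable_on Y"
    by (subst (asm) summable_on_reindex) (auto simp: inj_on_def o_def)
  then show ?thesis using assms by (auto simp: ell2_def)
next
  case False
  then show ?thesis using assms by (simp add: ell2_def)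
qed

lemma ell2_tensor:
  assumes "finite X" "\<phi> \<in> ell2 X" "\<psi> \<in> ell2 Y"
  shows "tensor \<phi> \<psi> \<in> ell2 (X \<times> Y)"
proof -
  have "(\<lambda>p. (cmod (tensor \<phi> \<psi> p))\<^sup>2) summable_on X \<times> Y"
    using assms
    by (intro summable_on_Sigma_finite)
      (auto simp: tensor_def ell2_def norm_mult power_mult_distrib intro: summable_on_cmult_right)
  then show ?thesis using assms by (auto simp: ell2_def tensor_def)
qed

text \<open>Fubini with a finite first factor. The hypothesis is summability of the product, not
  membership in \<open>ell2 Y\<close>, because the result is later applied to images of kets for
  which only that is derived.\<close>

lemma ell2_inner_tensor:
  assumes "finite X" and summable: "(\<lambda>y. cnj (\<phi> y) * \<psi> y) summable_on Y"
  shows "ell2_inner (X \<times> Y) (tensor v \<phi>) (tensor w \<psi>) = ell2_inner X v w * ell2_inner Y \<phi> \<psi>"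
proof -
  let ?g = "\<lambda>p. cnj (tensor v \<phi> p) * tensor w \<psi> p"
  have g: "?g (a, y) = (cnj (v a) * w a) * (cnj (\<phi> y) * \<psi> y)" for a y
    by (simp add: tensor_def)
  have "?g summable_on X \<times> Y"
    using assms by (intro summable_on_Sigma_finite) (simp_all only: g summable_on_cmult_right)
  then have "infsum ?g (X \<times> Y) = (\<Sum>a\<in>X. infsum (\<lambda>y. ?g (a, y)) Y)"
    using \<open>finite X\<close> by (subst infsum_Sigma_banach[symmetric]) simp_all
  also have "\<dots> = (\<Sum>a\<in>X. cnj (v a) * w a) * infsum (\<lambda>y. cnj (\<phi> y) * \<psi> y) Y"
    unfolding g sum_distrib_right
    by (intro sum.cong refl infsum_cmult_right) (use summable in auto)
  finally show ?thesis using \<open>finite X\<close> by (simp add: ell2_inner_def)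
qed

section \<open>Characters of a product of cyclic groups\<close>

text \<open>A finite Abelian group is isomorphic to its dual, so the characters are labelled by
  elements \<open>c\<close> of the group itself. The formula is symmetric in \<open>c\<close> and
  \<open>f\<close>.\<close>

definition cyclic_character ::
  "nat \<Rightarrow> (nat \<Rightarrow> nat) \<Rightarrow> (nat \<Rightarrow> int) \<Rightarrow> (nat \<Rightarrow> int) \<Rightarrow> complex" where
  "cyclic_character n i c f = (\<Prod>m=1..n. cis (2 * pi * of_int (c m * f m) / of_nat (i m)))"

text \<open>This symmetry later turns orthogonality of the characters into their
  completeness.\<close>

lemma cyclic_character_commute: "cyclic_character n i c f = cyclic_character n i f c"
  by (simp add: cyclic_character_def mult.commute)

text \<open>Reducing \<open>a\<close> modulo \<open>m\<close> changes the angle by full turns only;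
  hence the characters respect the reduced addition of the cyclic groups.\<close>

lemma cis_of_int_mod:
  assumes "0 < m"
  shows "cis (2 * pi * of_int (c * (a mod int m)) / of_nat m) = cis (2 * pi * of_int (c * a) / of_nat m)"
proof -
  have *: "real_of_int a = of_nat m * of_int (a div int m) + of_int (a mod int m)"
    by (metis mult_div_mod_eq of_int_add of_int_mult of_int_of_nat_eq)
  have "2 * pi * of_int (c * a) / of_nat m =
      2 * pi * of_int (c * (a mod int m)) / of_nat m + 2 * pi * of_int (c * (a div int m))"
    using assms by (simp add: * field_simps)
  then show ?thesis
    by (simp add: cis_mult[symmetric] cis_multiple_2pi)
qed

lemma cyclic_character_mult:
  assumes "\<And>j. j \<in> {1..n} \<Longrightarrow> 1 \<le> i j"
  shows "cyclic_character n i c (a \<otimes>\<^bsub>cyclic_product n i\<^esub> b) =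
    cyclic_character n i c a * cyclic_character n i c b"
  unfolding cyclic_character_def prod.distrib[symmetric]
proof (rule prod.cong)
  fix m assume m: "m \<in> {1..n}"
  then have "0 < i m" using assms[OF m] by simp
  have "cis (2 * pi * of_int (c m * ((a m + b m) mod int (i m))) / of_nat (i m)) =
     cis (2 * pi * of_int (c m * (a m + b m)) / of_nat (i m))"
    by (rule cis_of_int_mod) fact
  with m show "cis (2 * pi * of_int (c m * (a \<otimes>\<^bsub>cyclic_product n i\<^esub> b) m) / of_nat (i m)) =
    cis (2 * pi * of_int (c m * a m) / of_nat (i m)) * cis (2 * pi * of_int (c m * b m) / of_nat (i m))"
    by (simp add: cyclic_product_def cis_mult add_divide_distrib ring_distribs)
qed simp

text \<open>The terms are the powers of one \<open>m\<close>-th root of unity \<open>w\<close>, so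
  for \<open>w\<close> different from 1 the geometric sum vanishes.\<close>

lemma sum_roots_of_unity:
  assumes "0 < m" "c \<in> {0..<int m}" "c' \<in> {0..<int m}"
  shows "(\<Sum>a\<in>{0..<int m}. cnj (cis (2 * pi * of_int (c * a) / of_nat m)) *
      cis (2 * pi * of_int (c' * a) / of_nat m)) = (if c = c' then of_nat m else 0)"
proof -
  define w where "w = cis (2 * pi * of_int (c' - c) / of_nat m)"
  have "(\<Sum>a\<in>{0..<int m}. cnj (cis (2 * pi * of_int (c * a) / of_nat m)) *
      cis (2 * pi * of_int (c' * a) / of_nat m)) = (\<Sum>k<m. w ^ k)"
  proof (rule sum.reindex_bij_witness[of _ int nat])
    fix a assume a: "a \<in> {0..<int m}"
    then have "real (nat a) = real_of_int a" by simp
    then have "real (nat a) * (2 * pi * of_int (c' - c) / of_nat m) =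
        - (2 * pi * of_int (c * a) / of_nat m) + 2 * pi * of_int (c' * a) / of_nat m"
      using assms by (simp add: field_simps)
    then show "w ^ nat a = cnj (cis (2 * pi * of_int (c * a) / of_nat m)) *
      cis (2 * pi * of_int (c' * a) / of_nat m)"
      unfolding w_def DeMoivre cis_cnj cis_mult by (rule arg_cong)
  qed (auto simp: nat_less_iff)
  also have "\<dots> = (if c = c' then of_nat m else 0)"
  proof (cases "c = c'")
    case False
    have "w ^ m = 1"
      using assms by (simp add: w_def DeMoivre cis_multiple_2pi)
    \<comment> \<open>If \<open>w = 1\<close>, then \<open>m\<close> divides \<open>c' - c\<close>,
      which is impossible for distinct residues in the range from 0 to \<open>m - 1\<close>.\<close>
    moreover have "w \<noteq> 1"
    proof
      assume "w = 1"
      then obtain k :: int where "2 * pi * of_int (c' - c) / of_nat m = of_int k * (2 * pi)"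
        unfolding w_def complex_eq_iff by (auto simp: cos_one_2pi_int)
      then have "(2 * pi) * real_of_int (c' - c) = (2 * pi) * real_of_int (k * int m)"
        using assms(1) by (simp add: divide_eq_eq mult_ac)
      then have "real_of_int (c' - c) = real_of_int (k * int m)"
        by (subst (asm) mult_cancel_left) simp
      then have "c' - c = k * int m" by linarith
      then have "int m dvd c' - c" by simp
      then have "c' mod int m = c mod int m" by (simp add: mod_eq_dvd_iff)
      then show False using False assms by simp
    qed
    ultimately show ?thesis using False by (simp add: geometric_sum)
  qed (simp add: w_def)
  finally show ?thesis .
qed

lemma carrier_cyclic_product:
  assumes "\<And>j. j \<in> {1..n} \<Longrightarrow> 1 \<le> i j"
  shows "carrier (cyclic_product n i) = (\<Pi>\<^sub>E m\<in>{1..n}. {0..<int (i m)})"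
  unfolding cyclic_product_def carrier_product_group
proof (rule PiE_cong)
  show "carrier (integer_mod_group (i m)) = {0..<int (i m)}" if "m \<in> {1..n}" for m
    using assms[OF that] by (simp add: carrier_integer_mod_group)
qed

text \<open>Both the characters and the carrier are products over the coordinates, so the sum
  factors into one root-of-unity sum per coordinate; a single differing coordinate makes it
  vanish.\<close>

lemma cyclic_character_orthogonal:
  assumes i: "\<And>j. j \<in> {1..n} \<Longrightarrow> 1 \<le> i j"
    and c: "c \<in> carrier (cyclic_product n i)" "c' \<in> carrier (cyclic_product n i)"
  shows "(\<Sum>f\<in>carrier (cyclic_product n i). cnj (cyclic_character n i c f) * cyclic_character n i c' f) =
    (if c = c' then of_nat (\<Prod>m=1..n. i m) else 0)"
proof -
  have carrier: "carrier (cyclic_product n i) = (\<Pi>\<^sub>E m\<in>{1..n}. {0..<int (i m)})"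
    using i by (rule carrier_cyclic_product)
  have "(\<Sum>f\<in>carrier (cyclic_product n i). cnj (cyclic_character n i c f) * cyclic_character n i c' f) =
     (\<Sum>f\<in>(\<Pi>\<^sub>E m\<in>{1..n}. {0..<int (i m)}). \<Prod>m=1..n.
        cnj (cis (2 * pi * of_int (c m * f m) / of_nat (i m))) * cis (2 * pi * of_int (c' m * f m) / of_nat (i m)))"
    by (rule sum.cong[OF carrier])
      (simp_all add: cyclic_character_def prod.distrib)
  also have "\<dots> = (\<Prod>m=1..n. \<Sum>a\<in>{0..<int (i m)}.
        cnj (cis (2 * pi * of_int (c m * a) / of_nat (i m))) * cis (2 * pi * of_int (c' m * a) / of_nat (i m)))"
    by (rule prod_sum_PiE[symmetric]) auto
  also have "\<dots> = (\<Prod>m=1..n. if c m = c' m then of_nat (i m) else 0)"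
  proof (rule prod.cong)
    fix m assume m: "m \<in> {1..n}"
    show "(\<Sum>a\<in>{0..<int (i m)}. cnj (cis (2 * pi * of_int (c m * a) / of_nat (i m))) *
        cis (2 * pi * of_int (c' m * a) / of_nat (i m))) = (if c m = c' m then of_nat (i m) else 0)"
      using c[unfolded carrier, THEN PiE_mem, OF m] i[OF m]
      by (intro sum_roots_of_unity) auto
  qed simp
  also have "\<dots> = (if c = c' then of_nat (\<Prod>m=1..n. i m) else 0)"
  proof (cases "c = c'")
    case False
    then obtain m where "m \<in> {1..n}" "c m \<noteq> c' m"
      using c unfolding carrier by (metis PiE_ext)
    then have "(\<Prod>m=1..n. if c m = c' m then of_nat (i m) else 0) = (0 :: complex)"
      by (intro prod_zero) auto
    then show ?thesis using False by simp
  qed simp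
  finally show ?thesis .
qed

section \<open>Isometries in the group algebra of the lattice\<close>

text \<open>
  The pair is chosen at maximal Euclidean distance: if \<open>a' - b' = a - b\<close>, the parallelogram law
  makes one of \<open>a - b'\<close> and \<open>a' - b\<close> longer than \<open>a - b\<close> unless \<open>a' = a\<close>.
\<close>

lemma unique_difference:
  fixes P :: "(nat \<Rightarrow> int) set"
  assumes "finite P" "P \<noteq> {}" "P \<subseteq> extensional {1..d}"
  obtains a b where "a \<in> P" "b \<in> P"
    and "\<And>a' b'. a' \<in> P \<Longrightarrow> b' \<in> P \<Longrightarrow> \<forall>m\<in>{1..d}. a' m - b' m = a m - b m \<Longrightarrow> a' = a"
    and "a = b \<Longrightarrow> P = {a}"
proof -
  define D :: "(nat \<Rightarrow> int) \<Rightarrow> (nat \<Rightarrow> int) \<Rightarrow> int" where "D a b = (\<Sum>m=1..d. (a m - b m)\<^sup>2)" for a b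
  \<comment> \<open>\<open>D\<close> sees only the coordinates in \<open>{1..d}\<close>;
    extensionality of the points of \<open>P\<close> makes it separate them.\<close>
  have D0: "x = y" if "D x y \<le> 0" "x \<in> P" "y \<in> P" for x y
  proof -
    have "D x y = 0" using that unfolding D_def by (intro antisym sum_nonneg) auto
    then have "\<forall>m\<in>{1..d}. x m = y m" by (simp add: D_def sum_nonneg_eq_0_iff)
    then show ?thesis using that assms(3) by (auto intro: extensionalityI)
  qed
  let ?DP = "(\<lambda>(x, y). D x y) ` (P \<times> P)"
  have "Max ?DP \<in> ?DP" using assms by (intro Max_in) auto
  then obtain a b where ab: "a \<in> P" "b \<in> P" "D a b = Max ?DP" by auto
  have max: "D x y \<le> D a b" if "x \<in> P" "y \<in> P" for x y
    unfolding ab(3) using that assms by (intro Max_ge) auto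
  show thesis
  proof (rule that[OF ab(1,2)])
    fix a' b' assume *: "a' \<in> P" "b' \<in> P" "\<forall>m\<in>{1..d}. a' m - b' m = a m - b m"
    have "D a b' + D a' b = (\<Sum>m=1..d. 2 * (a m - b m)\<^sup>2 + 2 * (a' m - a m)\<^sup>2)"
      unfolding D_def sum.distrib[symmetric]
    proof (rule sum.cong)
      fix m assume "m \<in> {1..d}"
      then have "a' m - b' m = a m - b m" using *(3) by blast
      then have "b' m = a' m - a m + b m" by linarith
      show "(a m - b' m)\<^sup>2 + (a' m - b m)\<^sup>2 = 2 * (a m - b m)\<^sup>2 + 2 * (a' m - a m)\<^sup>2"
        unfolding \<open>b' m = _\<close> by (simp add: power2_eq_square algebra_simps)
    qed simp
    also have "\<dots> = 2 * D a b + 2 * D a' a"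
      by (simp add: D_def sum.distrib sum_distrib_left)
    \<comment> \<open>Each of the two squared distances on the left is at most the maximum
      \<open>D a b\<close>.\<close>
    finally have "D a' a \<le> 0" using max[OF ab(1) *(2)] max[OF *(1) ab(2)] by linarith
    then show "a' = a" using D0 * ab by blast
  next
    assume "a = b"
    then have "D x a \<le> 0" if "x \<in> P" for x using max[OF that ab(1)] by (simp add: D_def)
    then show "P = {a}" using D0 ab by blast
  qed
qed

lemma int_lattice_mult: "x \<otimes>\<^bsub>int_lattice d\<^esub> y = (\<lambda>m\<in>{1..d}. x m + y m)"
  by (simp add: int_lattice_def)

lemma carrier_int_lattice: "carrier (int_lattice d) = extensional {1..d}"
  by (simp add: int_lattice_def PiE_def)

text \<open>The vector \<open>v\<close> is a common eigenvector of the right translations of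
  \<open>F\<close>, so each \<open>T_f\<close> in \<open>A\<close> may be replaced by the scalar
  \<open>\<chi> f\<close>. Only shifts on the second leg remain.\<close>

lemma scalar_quantum_walk_tensor:
  assumes walk: "scalar_quantum_walk (F \<times>\<times> H) S z A"
    and fin: "finite (carrier F)"
    and v: "v \<in> ell2 (carrier F)"
    and \<chi>: "\<And>a f. a \<in> carrier F \<Longrightarrow> f \<in> carrier F \<Longrightarrow> v (a \<otimes>\<^bsub>F\<^esub> f) = \<chi> f * v a"
    and \<phi>: "\<phi> \<in> ell2 (carrier H)"
  shows "A (tensor v \<phi>) =
    tensor v (\<lambda>y. \<Sum>p\<in>S. z p * \<chi> (fst p) * right_regular H (snd p) \<phi> y)"
proof -
  have S: "S \<subseteq> carrier F \<times> carrier H"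
    using walk by (simp add: scalar_quantum_walk_def)
  have "A (tensor v \<phi>) = (\<lambda>x. \<Sum>p\<in>S. z p * right_regular (F \<times>\<times> H) p (tensor v \<phi>) x)"
    using walk ell2_tensor[OF fin v \<phi>] by (simp add: scalar_quantum_walk_def)
  also have "\<dots> = tensor v (\<lambda>y. \<Sum>p\<in>S. z p * \<chi> (fst p) * right_regular H (snd p) \<phi> y)"
  proof (rule ext, clarify)
    fix a y
    have "right_regular (F \<times>\<times> H) p (tensor v \<phi>) (a, y) =
        v a * (\<chi> (fst p) * right_regular H (snd p) \<phi> y)" if "p \<in> S" for p
      using that S \<chi> ell2_outside[OF v, of a]
      by (cases p) (auto simp: right_regular_def tensor_def)
    then show "(\<Sum>p\<in>S. z p * right_regular (F \<times>\<times> H) p (tensor v \<phi>) (a, y)) =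
        tensor v (\<lambda>y. \<Sum>p\<in>S. z p * \<chi> (fst p) * right_regular H (snd p) \<phi> y) (a, y)"
      by (simp add: tensor_def sum_distrib_left mult_ac)
  qed
  finally show ?thesis .
qed

text \<open>Quantifying over \<open>g\<close> says that the coefficients, collected by lattice
  point, form a phase times a point mass at \<open>h\<close>. Taking shifts for \<open>g\<close>
  gives the action on the sector of \<open>v\<close>; taking exponentials gives the eigenvalue of
  the Fourier symbol.\<close>

lemma scalar_quantum_walk_character:
  fixes S :: "('f \<times> (nat \<Rightarrow> int)) set"
  assumes walk: "scalar_quantum_walk (F \<times>\<times> int_lattice d) S z A"
    and fin: "finite (carrier F)"
    and v: "v \<in> ell2 (carrier F)" "ell2_inner (carrier F) v v = 1"
    and \<chi>: "\<And>a f. a \<in> carrier F \<Longrightarrow> f \<in> carrier F \<Longrightarrow> v (a \<otimes>\<^bsub>F\<^esub> f) = \<chi> f * v a"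
  shows "\<exists>h\<in>carrier (int_lattice d). \<exists>\<theta>::real. \<forall>g :: (nat \<Rightarrow> int) \<Rightarrow> complex.
    (\<Sum>p\<in>S. z p * \<chi> (fst p) * g (snd p)) = exp (- (\<i> * of_real \<theta>)) * g h"
proof -
  let ?L = "int_lattice d" and ?C = "carrier (int_lattice d)"
  have S: "finite S" "S \<subseteq> carrier F \<times> ?C"
    using walk by (simp_all add: scalar_quantum_walk_def)
  \<comment> \<open>Elements of \<open>S\<close> with the same lattice part are merged. Their
    contributions may cancel although every \<open>z p\<close> is nonzero, so \<open>P\<close> keeps
    only the actual support.\<close>
  define w where "w x = (\<Sum>p\<in>{p\<in>S. snd p = x}. z p * \<chi> (fst p))" for x
  define P where "P = {x \<in> snd ` S. w x \<noteq> 0}"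
  have P: "finite P" "P \<subseteq> ?C" using S by (auto simp: P_def)
  have collect: "(\<Sum>p\<in>S. z p * \<chi> (fst p) * g (snd p)) = (\<Sum>x\<in>P. w x * g x)"
    for g :: "(nat \<Rightarrow> int) \<Rightarrow> complex"
  proof -
    have "(\<Sum>p\<in>S. z p * \<chi> (fst p) * g (snd p)) =
        (\<Sum>x\<in>snd ` S. \<Sum>p\<in>{p\<in>S. snd p = x}. z p * \<chi> (fst p) * g (snd p))"
      by (rule sum.image_gen) fact
    also have "\<dots> = (\<Sum>x\<in>snd ` S. w x * g x)"
      by (simp add: w_def sum_distrib_right)
    also have "\<dots> = (\<Sum>x\<in>P. w x * g x)"
      using S by (intro sum.mono_neutral_right) (auto simp: P_def)
    finally show ?thesis .
  qed
  \<comment> \<open>\<open>B a\<close> is the image of the basis vector at \<open>a\<close> under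
    the lattice operator induced by \<open>A\<close> on the sector of \<open>v\<close>.\<close>
  define B where "B a = (\<lambda>y. \<Sum>x\<in>P. w x * right_regular ?L x (ket a) y)" for a
  have A_ket: "A (tensor v (ket a)) = tensor v (B a)" if "a \<in> ?C" for a
    unfolding B_def
    using scalar_quantum_walk_tensor[OF walk fin v(1) \<chi> ell2_ket[OF that]]
    by (simp add: collect[of "\<lambda>x. right_regular ?L x (ket a) _"])
  have B_nonzero: "\<exists>x\<in>P. \<forall>m\<in>{1..d}. y m + x m = a m" if "B a y \<noteq> 0" for a y
  proof -
    obtain x where "x \<in> P" "right_regular ?L x (ket a) y \<noteq> 0"
      using \<open>B a y \<noteq> 0\<close> unfolding B_def by (metis (mono_tags, lifting) mult_zero_right sum.neutral)
    then show ?thesis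
      by (auto simp: right_regular_def ket_def int_lattice_mult split: if_splits)
  qed
  have B_outside: "B a y = 0" if "y \<notin> ?C" for a y
    using that by (simp add: B_def right_regular_def)
  have B_summable: "(\<lambda>y. cnj (B a y) * B b y) summable_on ?C" for a b
  proof -
    \<comment> \<open>\<open>B a\<close> is supported on the finitely many points
      \<open>a - x\<close> with \<open>x\<close> in \<open>P\<close>.\<close>
    have "B a y = 0" if "y \<notin> (\<lambda>x. \<lambda>m\<in>{1..d}. a m - x m) ` P" for y
    proof (rule ccontr)
      assume "B a y \<noteq> 0"
      with B_nonzero obtain x where x: "x \<in> P" "\<forall>m\<in>{1..d}. y m + x m = a m" by blast
      moreover have "y \<in> extensional {1..d}"
        using \<open>B a y \<noteq> 0\<close> B_outside carrier_int_lattice by blast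
      ultimately have "y = (\<lambda>m\<in>{1..d}. a m - x m)"
        by (intro extensionalityI[of _ "{1..d}"]) (auto simp: algebra_simps)
      with x that show False by blast
    qed
    then show ?thesis
      using P by (subst summable_on_cong_neutral[where
        T = "(\<lambda>x. \<lambda>m\<in>{1..d}. a m - x m) ` P" and g = "\<lambda>y. cnj (B a y) * B b y"])
        (auto simp: B_outside)
  qed
  have isometry: "ell2_inner ?C (B a) (B b) = (if a = b then 1 else 0)" if "a \<in> ?C" "b \<in> ?C" for a b
  proof -
    \<comment> \<open>Tensoring with the unit vector \<open>v\<close> preserves inner products,
      which transfers the isometry of \<open>A\<close> to the lattice.\<close>
    have "ell2_inner ?C (B a) (B b) = ell2_inner (carrier F \<times> ?C) (tensor v (B a)) (tensor v (B b))"
      using v(2) by (simp add: ell2_inner_tensor[OF fin B_summable])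
    also have "\<dots> = ell2_inner (carrier F \<times> ?C) (tensor v (ket a)) (tensor v (ket b))"
      unfolding A_ket[OF that(1), symmetric] A_ket[OF that(2), symmetric]
      using walk that v(1)
      by (auto simp: scalar_quantum_walk_def unitary_on_ell2_def intro!: ell2_tensor ell2_ket fin)
    also have "\<dots> = ell2_inner ?C (ket a) (ket b)"
      using v(2) by (simp add: ell2_inner_tensor[OF fin ell2_inner_summable] ell2_ket that)
    finally show ?thesis using that(1) by (simp add: ell2_inner_ket) (simp add: ket_def)
  qed
  define o0 :: "nat \<Rightarrow> int" where "o0 = (\<lambda>m\<in>{1..d}. 0)"
  have o0: "o0 \<in> ?C" by (simp add: o0_def carrier_int_lattice)
  have "P \<noteq> {}"
  proof
    assume "P = {}"
    then have "ell2_inner ?C (B o0) (B o0) = 0" by (simp add: B_def ell2_inner_def)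
    then show False using isometry[OF o0 o0] by simp
  qed
  then obtain a b where ab: "a \<in> P" "b \<in> P"
    and unique: "\<And>a' b'. a' \<in> P \<Longrightarrow> b' \<in> P \<Longrightarrow> \<forall>m\<in>{1..d}. a' m - b' m = a m - b m \<Longrightarrow> a' = a"
    and singleton: "a = b \<Longrightarrow> P = {a}"
    using unique_difference[OF P(1) _ P(2)[unfolded carrier_int_lattice]] by metis
  have abC: "a \<in> ?C" "b \<in> ?C" using ab P by auto
  \<comment> \<open>Shifting \<open>ket c\<close> by \<open>x\<close> puts it at
    \<open>c - x\<close>, which is the origin exactly for \<open>x = c\<close>.\<close>
  have B_o0: "B c o0 = w c" if "c \<in> P" for c
  proof -
    have "right_regular ?L x (ket c) o0 = (if x = c then 1 else 0)" if "x \<in> P" for x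
    proof -
      have "o0 \<otimes>\<^bsub>?L\<^esub> x = x" using that P(2)
        by (auto simp: int_lattice_mult o0_def carrier_int_lattice extensional_def fun_eq_iff)
      then show ?thesis using o0 by (simp add: right_regular_def ket_def)
    qed
    then show ?thesis using P(1) \<open>c \<in> P\<close> by (simp add: B_def if_distrib[of "(*) _"] cong: if_cong)
  qed
  have "ell2_inner ?C (B a) (B b) = cnj (w a) * w b"
    unfolding ell2_inner_def
  proof (rule infsumI, rule has_sum_finite_neutralI[where B = "{o0}"])
    \<comment> \<open>If both images are nonzero at \<open>y\<close>, then \<open>a - y\<close> and
      \<open>b - y\<close> lie in \<open>P\<close>. Their difference is that of \<open>a\<close> and
      \<open>b\<close>, so uniqueness forces \<open>y\<close> to be the origin.\<close>
    fix y assume y: "y \<in> ?C - {o0}"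
    show "cnj (B a y) * B b y = 0"
    proof (rule ccontr)
      assume "cnj (B a y) * B b y \<noteq> 0"
      then obtain a' b' where *: "a' \<in> P" "\<forall>m\<in>{1..d}. y m + a' m = a m"
        "b' \<in> P" "\<forall>m\<in>{1..d}. y m + b' m = b m" using B_nonzero by (metis complex_cnj_zero mult_eq_0_iff)
      have "a' m - b' m = a m - b m" if "m \<in> {1..d}" for m
        using *(2,4) that by (metis add_diff_cancel_left)
      then have "a' = a" using * unique by blast
      then have "\<forall>m\<in>{1..d}. y m = 0" using * by simp
      then have "y = o0"
        using y by (intro extensionalityI[of _ "{1..d}"]) (auto simp: o0_def carrier_int_lattice)
      then show False using y by simp
    qed
  qed (use o0 ab in \<open>auto simp: B_o0\<close>)
  then have w: "cnj (w a) * w b = (if a = b then 1 else 0)" using isometry[OF abC] by simp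
  moreover have "w a \<noteq> 0" "w b \<noteq> 0" using ab by (auto simp: P_def)
  ultimately have "a = b" by (auto split: if_splits)
  then have "cnj (w a) * w a = 1" using w by simp
  then have "cmod (w a) = 1"
    by (metis complex_mod_cnj norm_mult norm_one abs_norm_cancel real_sqrt_abs2 real_sqrt_one)
  \<comment> \<open>The coefficient has modulus 1. The phase convention is exp(-i \<theta>), so
    \<theta> is minus its argument.\<close>
  then have "exp (- (\<i> * of_real (- Arg (w a)))) = w a"
    using rcis_cmod_Arg[of "w a"] by (simp add: rcis_def cis_conv_exp)
  then show ?thesis
    using abC(1) singleton[OF \<open>a = b\<close>] unfolding collect
    by (intro bexI[of _ a] exI[of _ "- Arg (w a)"]) simp_all
qed

section \<open>Eigenbases\<close>

lemma linear_on_ell2_sum: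
  assumes U: "linear_on_ell2 X U" and "finite J" and \<phi>: "\<And>j. j \<in> J \<Longrightarrow> \<phi> j \<in> ell2 X"
  shows "U (\<lambda>x. \<Sum>j\<in>J. c j * \<phi> j x) = (\<lambda>x. \<Sum>j\<in>J. c j * U (\<phi> j) x)"
  using \<open>finite J\<close> \<phi>
proof (induction J)
  case empty
  \<comment> \<open>Linearity with both coefficients 0 yields that \<open>U\<close> maps the zero
    vector to itself.\<close>
  have "U (\<lambda>x. 0 * 0 + 0 * 0) = (\<lambda>x. 0 * U (\<lambda>x. 0) x + 0 * U (\<lambda>x. 0) x)"
    using U[unfolded linear_on_ell2_def, rule_format, OF ell2_zero ell2_zero] .
  then show ?case by simp
next
  case (insert j J)
  have "U (\<lambda>x. c j * \<phi> j x + 1 * (\<Sum>j\<in>J. c j * \<phi> j x)) =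
      (\<lambda>x. c j * U (\<phi> j) x + 1 * U (\<lambda>x. \<Sum>j\<in>J. c j * \<phi> j x) x)"
    using insert.prems
    by (intro U[unfolded linear_on_ell2_def, rule_format] ell2_sum ell2_scale) auto
  then show ?case using insert by simp
qed

text \<open>Expanding an eigenvector in the basis and comparing coefficients gives
  \<open>c k * e k = \<mu> * c k\<close>; some \<open>c k\<close> is nonzero, which identifies
  \<open>\<mu>\<close> with \<open>e k\<close>.\<close>

lemma eigenvalues_of_eigenbasis:
  assumes "finite X" "finite J" and basis: "orthonormal_basis X J v"
    and U: "linear_on_ell2 X U" and eigen: "\<And>j. j \<in> J \<Longrightarrow> U (v j) = (\<lambda>x. e j * v j x)"
  shows "{\<mu>. eigenvalue_on_ell2 X U \<mu>} = e ` J"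
proof (intro equalityI subsetI)
  fix \<mu> assume "\<mu> \<in> e ` J"
  then obtain j where j: "j \<in> J" "\<mu> = e j" by auto
  have "v j \<noteq> (\<lambda>x. 0)"
  proof
    assume "v j = (\<lambda>x. 0)"
    then have "ell2_inner X (v j) (v j) = 0" by (simp add: ell2_inner_def)
    then show False using basis j by (simp add: orthonormal_basis_def)
  qed
  then show "\<mu> \<in> {\<mu>. eigenvalue_on_ell2 X U \<mu>}"
    using basis j eigen by (auto simp: eigenvalue_on_ell2_def orthonormal_basis_def)
next
  fix \<mu> assume "\<mu> \<in> {\<mu>. eigenvalue_on_ell2 X U \<mu>}"
  then obtain \<psi> where \<psi>: "\<psi> \<in> ell2 X" "\<psi> \<noteq> (\<lambda>x. 0)" "U \<psi> = (\<lambda>x. \<mu> * \<psi> x)"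
    by (auto simp: eigenvalue_on_ell2_def)
  obtain c where c: "\<psi> = (\<lambda>x. \<Sum>j\<in>J. c j * v j x)"
    using basis \<psi>(1) unfolding orthonormal_basis_def by blast
  have inner: "ell2_inner X (v k) (\<lambda>x. \<Sum>j\<in>J. a j * v j x) = a k" if "k \<in> J" for a k
  proof -
    have "ell2_inner X (v k) (\<lambda>x. \<Sum>j\<in>J. a j * v j x) = (\<Sum>j\<in>J. a j * ell2_inner X (v k) (v j))"
      using \<open>finite X\<close> by (simp add: ell2_inner_def sum_distrib_left mult_ac sum.swap[of _ J X])
    also have "\<dots> = (\<Sum>j\<in>J. if k = j then a j else 0)"
      using basis that by (intro sum.cong) (auto simp: orthonormal_basis_def)
    finally show ?thesis using that \<open>finite J\<close> by simp
  qed
  have "U \<psi> = (\<lambda>x. \<Sum>j\<in>J. c j * U (v j) x)"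
    unfolding c using basis by (intro linear_on_ell2_sum[OF U \<open>finite J\<close>]) (simp add: orthonormal_basis_def)
  also have "\<dots> = (\<lambda>x. \<Sum>j\<in>J. (c j * e j) * v j x)"
    by (simp add: eigen mult.assoc)
  finally have "(\<lambda>x. \<Sum>j\<in>J. (c j * e j) * v j x) = U \<psi>" ..
  also have "\<dots> = (\<lambda>x. \<Sum>j\<in>J. (\<mu> * c j) * v j x)"
    unfolding \<psi>(3) by (simp add: c sum_distrib_left mult.assoc)
  finally have eq: "(\<lambda>x. \<Sum>j\<in>J. (c j * e j) * v j x) = (\<lambda>x. \<Sum>j\<in>J. (\<mu> * c j) * v j x)" .
  have coeff: "c k * e k = \<mu> * c k" if "k \<in> J" for k
    using inner[OF that, of "\<lambda>j. c j * e j"] inner[OF that, of "\<lambda>j. \<mu> * c j"]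
    unfolding eq by metis
  obtain k where "k \<in> J" "c k \<noteq> 0"
    using \<psi>(2) unfolding c by (metis (no_types, lifting) mult_zero_left sum.neutral)
  then show "\<mu> \<in> e ` J" using coeff[of k] by auto
qed

lemma linear_on_ell2_fourier_symbol: "linear_on_ell2 X (fourier_symbol F d S z k)"
  by (auto simp: linear_on_ell2_def fourier_symbol_def right_regular_def fun_eq_iff
    case_prod_beta sum_distrib_left sum.distrib[symmetric] algebra_simps intro!: sum.cong)

text \<open>The eigenvalue is the same collected sum over \<open>S\<close> as for the action on the
  lattice, with plane-wave factors in place of shifts.\<close>

lemma fourier_symbol_character:
  assumes S: "S \<subseteq> carrier F \<times> Y" and v: "v \<in> ell2 (carrier F)"
    and \<chi>: "\<And>a f. a \<in> carrier F \<Longrightarrow> f \<in> carrier F \<Longrightarrow> v (a \<otimes>\<^bsub>F\<^esub> f) = \<chi> f * v a"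
  shows "fourier_symbol F d S z k v =
    (\<lambda>a. (\<Sum>p\<in>S. z p * \<chi> (fst p) * exp (- (\<i> * of_real (wave_dot d k (snd p))))) * v a)"
proof
  fix a
  have *: "z p * exp (- (\<i> * of_real (wave_dot d k (snd p)))) * right_regular F (fst p) v a =
      z p * \<chi> (fst p) * exp (- (\<i> * of_real (wave_dot d k (snd p)))) * v a" if "p \<in> S" for p
    using that S \<chi> ell2_outside[OF v, of a] by (auto simp: right_regular_def)
  show "fourier_symbol F d S z k v a =
      (\<Sum>p\<in>S. z p * \<chi> (fst p) * exp (- (\<i> * of_real (wave_dot d k (snd p))))) * v a"
    unfolding fourier_symbol_def case_prod_beta sum_distrib_right prod.collapse
    by (intro sum.cong refl *)
qed

section \<open>Decomposition of the walk\<close>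

text \<open>The projection contracts the first leg of \<open>\<psi>\<close> with the conjugate of
  \<open>v\<close>; the shift commutes with this finite sum and acts on the resulting
  component.\<close>

lemma tensor_op_ketbra:
  assumes "finite X"
  shows "tensor_op X (ketbra X v v) (\<lambda>\<phi> x. e * right_regular H h \<phi> x) \<psi> =
    tensor v (\<lambda>x. e * right_regular H h (\<lambda>y. \<Sum>g\<in>X. cnj (v g) * \<psi> (g, y)) x)"
proof (rule ext, clarify)
  fix f x
  have inner: "ell2_inner X v (ket g) = cnj (v g)" if "g \<in> X" for g
    using \<open>finite X\<close> that
    by (simp add: ell2_inner_def ket_def if_distrib[of "(*) _"] cong: if_cong)
  have "right_regular H h (\<lambda>y. \<Sum>g\<in>X. cnj (v g) * \<psi> (g, y)) x =
      (\<Sum>g\<in>X. cnj (v g) * right_regular H h (\<lambda>y. \<psi> (g, y)) x)"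
    by (simp add: right_regular_def)
  then show "tensor_op X (ketbra X v v) (\<lambda>\<phi> x. e * right_regular H h \<phi> x) \<psi> (f, x) =
      tensor v (\<lambda>x. e * right_regular H h (\<lambda>y. \<Sum>g\<in>X. cnj (v g) * \<psi> (g, y)) x) (f, x)"
    by (simp add: tensor_op_def tensor_def ketbra_def inner sum_distrib_left mult_ac)
qed

theorem proposition1:
  fixes d n N :: nat and i :: "nat \<Rightarrow> nat"
    and F Z :: "(nat \<Rightarrow> int) monoid"
    and S :: "((nat \<Rightarrow> int) \<times> (nat \<Rightarrow> int)) set"
    and z :: "(nat \<Rightarrow> int) \<times> (nat \<Rightarrow> int) \<Rightarrow> complex"
    and A :: "((nat \<Rightarrow> int) \<times> (nat \<Rightarrow> int) \<Rightarrow> complex) \<Rightarrow> ((nat \<Rightarrow> int) \<times> (nat \<Rightarrow> int) \<Rightarrow> complex)"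
  assumes d: "1 \<le> d"
    and i: "\<And>j. j \<in> {1..n} \<Longrightarrow> 1 \<le> i j"
    and F: "F = cyclic_product n i"
    and Z: "Z = int_lattice d"
    and N: "N = (\<Prod>j=1..n. i j)"
    and walk: "scalar_quantum_walk (F \<times>\<times> Z) S z A"
  shows "N = order F \<and>
    (\<exists>(v :: nat \<Rightarrow> (nat \<Rightarrow> int) \<Rightarrow> complex) (h :: nat \<Rightarrow> nat \<Rightarrow> int) (\<theta> :: nat \<Rightarrow> real).
       orthonormal_basis (carrier F) {1..N} v \<and>
       (\<forall>j\<in>{1..N}. h j \<in> carrier Z) \<and>
       (\<forall>\<psi>\<in>ell2 (carrier (F \<times>\<times> Z)).
          A \<psi> = (\<lambda>p. \<Sum>j=1..N.
            tensor_op (carrier F) (ketbra (carrier F) (v j) (v j))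
              (\<lambda>\<phi> x. exp (- (\<i> * of_real (\<theta> j))) * right_regular Z (h j) \<phi> x) \<psi> p)) \<and>
       orthogonal_direct_sum (carrier (F \<times>\<times> Z)) {1..N} (\<lambda>j. tensor (v j) ` ell2 (carrier Z)) \<and>
       (\<forall>j\<in>{1..N}. \<forall>\<phi>\<in>ell2 (carrier Z).
          A (tensor (v j) \<phi>) =
            tensor (v j) (\<lambda>x. exp (- (\<i> * of_real (\<theta> j))) * right_regular Z (h j) \<phi> x)) \<and>
       (\<forall>k :: nat \<Rightarrow> real.
          {\<mu>. eigenvalue_on_ell2 (carrier F) (fourier_symbol F d S z k) \<mu>} =
            (\<lambda>j. exp (- (\<i> * of_real (wave_dot d k (h j) + \<theta> j)))) ` {1..N} \<and>
          (\<forall>j\<in>{1..N}. fourier_symbol F d S z k (v j) =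
             (\<lambda>f. exp (- (\<i> * of_real (wave_dot d k (h j) + \<theta> j))) * v j f))))"
proof -

  \<comment> \<open>The orthonormal basis of normalised characters\<close>
  let ?F = "carrier F" and ?J = "{1..N}" and ?\<chi> = "cyclic_character n i"
  have carrier: "?F = (\<Pi>\<^sub>E m\<in>{1..n}. {0..<int (i m)})"
    unfolding F using i by (rule carrier_cyclic_product)
  have fin: "finite ?F" unfolding carrier by (intro finite_PiE) auto
  have order: "N = order F"
    by (simp add: order_def carrier card_PiE N)
  have "N \<noteq> 0" using i by (force simp: N)
  have F_closed: "a \<otimes>\<^bsub>F\<^esub> b \<in> ?F" if "a \<in> ?F" "b \<in> ?F" for a b
  proof -
    have "group F" by (simp add: F cyclic_product_def)
    then show ?thesis using that by (simp add: group.is_monoid monoid.m_closed)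
  qed
  have orthogonal: "(\<Sum>f\<in>?F. cnj (?\<chi> c f) * ?\<chi> c' f) = (if c = c' then of_nat N else 0)"
    if "c \<in> ?F" "c' \<in> ?F" for c c'
    using that unfolding F N by (intro cyclic_character_orthogonal i)
  \<comment> \<open>\<open>\<beta>\<close> numbers the group elements, and through them the
    characters, by 1 to \<open>N\<close>.\<close>
  obtain \<beta> where \<beta>: "bij_betw \<beta> ?J ?F"
    using ex_bij_betw_nat_finite_1[OF fin] order by (auto simp: order_def)
  then have \<beta>F: "\<beta> j \<in> ?F" if "j \<in> ?J" for j using that by (auto dest: bij_betwE)
  \<comment> \<open>Each character has squared norm \<open>N\<close>, hence the factor. The value 0
    off the carrier is the support convention of \<open>ell2\<close>.\<close>
  define v where "v j f = (if f \<in> ?F then ?\<chi> (\<beta> j) f / of_real (sqrt (real N)) else 0)" for j f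
  have vv: "cnj (v j f) * v k g = cnj (?\<chi> (\<beta> j) f) * ?\<chi> (\<beta> k) g / of_nat N" if "f \<in> ?F" "g \<in> ?F" for j k f g
  proof -
    have "of_real (sqrt (real N)) * of_real (sqrt (real N)) = (of_nat N :: complex)"
      by (simp flip: of_real_mult)
    then show ?thesis using that by (simp add: v_def)
  qed
  have v_ell2: "v j \<in> ell2 ?F" for j
    by (simp add: ell2_finite[OF fin] v_def)
  have v_inner: "ell2_inner ?F (v j) (v k) = (if j = k then 1 else 0)" if "j \<in> ?J" "k \<in> ?J" for j k
  proof -
    have "ell2_inner ?F (v j) (v k) = (\<Sum>f\<in>?F. cnj (?\<chi> (\<beta> j) f) * ?\<chi> (\<beta> k) f) / of_nat N"
      using fin by (simp add: ell2_inner_def vv sum_divide_distrib)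
    moreover have "\<beta> j = \<beta> k \<longleftrightarrow> j = k"
      using \<beta> that by (meson bij_betw_imp_inj_on inj_on_eq_iff)
    ultimately show ?thesis using \<open>N \<noteq> 0\<close> that by (simp add: orthogonal \<beta>F)
  qed
  have complete: "(\<Sum>j\<in>?J. cnj (v j g) * v j f) = (if g = f then 1 else 0)"
    if "f \<in> ?F" "g \<in> ?F" for f g
  proof -
    \<comment> \<open>Exchanging label and argument makes the sum over characters an inner product
      of the characters labelled \<open>g\<close> and \<open>f\<close>.\<close>
    have "(\<Sum>j\<in>?J. cnj (v j g) * v j f) = (\<Sum>j\<in>?J. cnj (?\<chi> g (\<beta> j)) * ?\<chi> f (\<beta> j) / of_nat N)"
      using that by (simp only: vv cyclic_character_commute[of n i "\<beta> _"])
    also have "\<dots> = (\<Sum>c\<in>?F. cnj (?\<chi> g c) * ?\<chi> f c / of_nat N)"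
      by (rule sum.reindex_bij_betw[OF \<beta>])
    also have "\<dots> = (if g = f then 1 else 0)"
      using \<open>N \<noteq> 0\<close> that by (simp add: orthogonal flip: sum_divide_distrib)
    finally show ?thesis .
  qed
  \<comment> \<open>This resolution of the identity is pointwise and holds for an arbitrary
    function, so it also applies to \<open>\<psi>\<close> with its lattice coordinate fixed.\<close>
  have expand: "\<psi> f = (\<Sum>j\<in>?J. v j f * (\<Sum>g\<in>?F. cnj (v j g) * \<psi> g))"
    if "f \<in> ?F" for \<psi> :: "_ \<Rightarrow> complex" and f
  proof -
    have "(\<Sum>j\<in>?J. v j f * (\<Sum>g\<in>?F. cnj (v j g) * \<psi> g)) =
        (\<Sum>g\<in>?F. (\<Sum>j\<in>?J. cnj (v j g) * v j f) * \<psi> g)"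
      unfolding sum_distrib_left sum_distrib_right
      by (subst sum.swap) (simp only: mult_ac)
    also have "\<dots> = (\<Sum>g\<in>?F. if g = f then \<psi> g else 0)"
      using that by (intro sum.cong) (auto simp: complete simp del: One_nat_def)
    finally show ?thesis using that fin by simp
  qed
  have basis: "orthonormal_basis ?F ?J v"
    unfolding orthonormal_basis_def
  proof (intro conjI ballI)
    fix \<psi> assume \<psi>: "\<psi> \<in> ell2 ?F"
    have "\<psi> f = (\<Sum>j\<in>?J. (\<Sum>g\<in>?F. cnj (v j g) * \<psi> g) * v j f)" for f
    proof (cases "f \<in> ?F")
      case True
      then show ?thesis using expand[OF True, of \<psi>] by (simp add: mult.commute)
    next
      case False
      then show ?thesis using ell2_outside[OF \<psi> False] by (simp add: v_def)
    qed
    then show "\<exists>c. \<psi> = (\<lambda>x. \<Sum>j\<in>?J. c j * v j x)"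
      by (intro exI[of _ "\<lambda>j. \<Sum>g\<in>?F. cnj (v j g) * \<psi> g"] ext)
  qed (simp_all add: v_ell2 v_inner)

  \<comment> \<open>The walk on each character sector\<close>
  have character: "v j (a \<otimes>\<^bsub>F\<^esub> f) = ?\<chi> (\<beta> j) f * v j a" if "a \<in> ?F" "f \<in> ?F" for j a f
    using that F_closed[OF that] cyclic_character_mult[of n i "\<beta> j" a f] i
    by (simp add: v_def flip: F)
  \<comment> \<open>Naming the property hides the quantifier over \<open>g\<close> while
    \<open>h\<close> and \<open>\<theta>\<close> are chosen for all \<open>j\<close> at
    once.\<close>
  define is_shift where "is_shift j h \<theta> \<longleftrightarrow> (\<forall>g :: (nat \<Rightarrow> int) \<Rightarrow> complex.
      (\<Sum>p\<in>S. z p * ?\<chi> (\<beta> j) (fst p) * g (snd p)) = exp (- (\<i> * of_real \<theta>)) * g h)" for j h \<theta>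
  have "\<exists>h\<in>carrier Z. \<exists>\<theta>. is_shift j h \<theta>" if "j \<in> ?J" for j
    unfolding Z is_shift_def
  proof (rule scalar_quantum_walk_character)
    show "scalar_quantum_walk (F \<times>\<times> int_lattice d) S z A" using walk by (simp only: Z)
    show "ell2_inner ?F (v j) (v j) = 1" using v_inner[OF that that] by simp
  qed (fact fin v_ell2 character)+
  then obtain h \<theta> where hZ: "\<And>j. j \<in> ?J \<Longrightarrow> h j \<in> carrier Z"
    and is_shift: "\<And>j. j \<in> ?J \<Longrightarrow> is_shift j (h j) (\<theta> j)"
    by metis
  have shift: "(\<Sum>p\<in>S. z p * ?\<chi> (\<beta> j) (fst p) * g (snd p)) = exp (- (\<i> * of_real (\<theta> j))) * g (h j)"
    if "j \<in> ?J" for j and g :: "(nat \<Rightarrow> int) \<Rightarrow> complex"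
    using is_shift[OF that] unfolding is_shift_def by blast
  have A_tensor: "A (tensor (v j) \<phi>) =
      tensor (v j) (\<lambda>x. exp (- (\<i> * of_real (\<theta> j))) * right_regular Z (h j) \<phi> x)"
    if "j \<in> ?J" "\<phi> \<in> ell2 (carrier Z)" for j \<phi>
  proof -
    have "A (tensor (v j) \<phi>) =
        tensor (v j) (\<lambda>y. \<Sum>p\<in>S. z p * ?\<chi> (\<beta> j) (fst p) * right_regular Z (snd p) \<phi> y)"
      by (rule scalar_quantum_walk_tensor[OF walk]) (fact fin v_ell2 character that)+
    then show ?thesis
      using shift[OF that(1), of "\<lambda>x. right_regular Z x \<phi> _"] by simp
  qed

  \<comment> \<open>Decomposition of the whole space and of the walk\<close>
  define \<pi> where "\<pi> \<psi> j y = (\<Sum>g\<in>?F. cnj (v j g) * \<psi> (g, y))"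
    for \<psi> :: "(nat \<Rightarrow> int) \<times> (nat \<Rightarrow> int) \<Rightarrow> complex" and j y
  have \<pi>: "\<pi> \<psi> j \<in> ell2 (carrier Z)" if "\<psi> \<in> ell2 (carrier (F \<times>\<times> Z))" for \<psi> j
    unfolding \<pi>_def using that by (auto intro!: ell2_sum ell2_scale ell2_slice)
  \<comment> \<open>\<open>\<pi> \<psi> j\<close> is the partial inner product of \<open>v j\<close>
    with \<open>\<psi>\<close>, that is, the lattice component of \<open>\<psi>\<close> in sector
    \<open>j\<close>.\<close>
  have decompose: "\<psi> = (\<lambda>p. \<Sum>j\<in>?J. tensor (v j) (\<pi> \<psi> j) p)"
    if "\<psi> \<in> ell2 (carrier (F \<times>\<times> Z))" for \<psi>
  proof (rule ext, clarify)
    fix f y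
    show "\<psi> (f, y) = (\<Sum>j\<in>?J. tensor (v j) (\<pi> \<psi> j) (f, y))"
    proof (cases "f \<in> ?F")
      case True
      then show ?thesis using expand[OF True, of "\<lambda>f. \<psi> (f, y)"] by (simp add: tensor_def \<pi>_def)
    next
      case False
      then show ?thesis using ell2_outside[OF that, of "(f, y)"] by (simp add: tensor_def v_def)
    qed
  qed
  have A_decomposed: "A \<psi> = (\<lambda>p. \<Sum>j=1..N. tensor_op ?F (ketbra ?F (v j) (v j))
      (\<lambda>\<phi> x. exp (- (\<i> * of_real (\<theta> j))) * right_regular Z (h j) \<phi> x) \<psi> p)"
    if \<psi>: "\<psi> \<in> ell2 (carrier (F \<times>\<times> Z))" for \<psi>
  proof -
    have "linear_on_ell2 (carrier (F \<times>\<times> Z)) A"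
      using walk by (simp add: scalar_quantum_walk_def unitary_on_ell2_def)
    \<comment> \<open>The coefficients 1 bring the decomposition into the shape of
      \<open>linear_on_ell2_sum\<close>.\<close>
    then have "A (\<lambda>p. \<Sum>j\<in>?J. 1 * tensor (v j) (\<pi> \<psi> j) p) = (\<lambda>p. \<Sum>j\<in>?J. 1 * A (tensor (v j) (\<pi> \<psi> j)) p)"
      using \<pi>[OF \<psi>] by (intro linear_on_ell2_sum) (auto intro: ell2_tensor fin v_ell2)
    then have "A \<psi> = (\<lambda>p. \<Sum>j\<in>?J. A (tensor (v j) (\<pi> \<psi> j)) p)"
      using decompose[OF \<psi>] by simp
    also have "\<dots> = (\<lambda>p. \<Sum>j\<in>?J. tensor_op ?F (ketbra ?F (v j) (v j))
      (\<lambda>\<phi> x. exp (- (\<i> * of_real (\<theta> j))) * right_regular Z (h j) \<phi> x) \<psi> p)"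
      unfolding tensor_op_ketbra[OF fin] using A_tensor \<pi>[OF \<psi>]
      by (intro ext sum.cong) (simp_all add: \<pi>_def[abs_def])
    finally show ?thesis .
  qed
  have direct_sum: "orthogonal_direct_sum (carrier (F \<times>\<times> Z)) ?J (\<lambda>j. tensor (v j) ` ell2 (carrier Z))"
    unfolding orthogonal_direct_sum_def
  proof (intro conjI ballI allI impI)
    fix j
    show "tensor (v j) ` ell2 (carrier Z) \<subseteq> ell2 (carrier (F \<times>\<times> Z))"
      by (auto intro: ell2_tensor fin v_ell2)
    show "(\<lambda>x. 0) \<in> tensor (v j) ` ell2 (carrier Z)"
      by (rule image_eqI[OF _ ell2_zero]) (auto simp: tensor_def)
  next
    fix j \<phi> \<psi> and a b :: complex
    assume "\<phi> \<in> tensor (v j) ` ell2 (carrier Z)" "\<psi> \<in> tensor (v j) ` ell2 (carrier Z)"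
    then obtain \<phi>' \<psi>' where *: "\<phi> = tensor (v j) \<phi>'" "\<psi> = tensor (v j) \<psi>'"
      "\<phi>' \<in> ell2 (carrier Z)" "\<psi>' \<in> ell2 (carrier Z)" by auto
    show "(\<lambda>x. a * \<phi> x + b * \<psi> x) \<in> tensor (v j) ` ell2 (carrier Z)"
      by (rule image_eqI[of _ _ "\<lambda>x. a * \<phi>' x + b * \<psi>' x"])
        (use * in \<open>auto simp: tensor_def fun_eq_iff algebra_simps intro: ell2_add ell2_scale\<close>)
  next
    fix j k \<phi> \<psi>
    assume "j \<in> ?J" "k \<in> ?J" "j \<noteq> k"
      "\<phi> \<in> tensor (v j) ` ell2 (carrier Z)" "\<psi> \<in> tensor (v k) ` ell2 (carrier Z)"
    \<comment> \<open>The inner product factors, and its first factor vanishes because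
      \<open>v j\<close> and \<open>v k\<close> are orthogonal.\<close>
    then show "ell2_inner (carrier (F \<times>\<times> Z)) \<phi> \<psi> = 0"
      by (auto simp: ell2_inner_tensor[OF fin ell2_inner_summable] v_inner)
  next
    fix \<psi> assume \<psi>: "\<psi> \<in> ell2 (carrier (F \<times>\<times> Z))"
    show "\<exists>\<phi>. (\<forall>j\<in>?J. \<phi> j \<in> tensor (v j) ` ell2 (carrier Z)) \<and> \<psi> = (\<lambda>x. \<Sum>j\<in>?J. \<phi> j x)"
      using decompose[OF \<psi>] \<pi>[OF \<psi>] by (intro exI[of _ "\<lambda>j. tensor (v j) (\<pi> \<psi> j)"]) auto
  qed

  \<comment> \<open>Eigenvalues of the Fourier symbol\<close>
  have symbol: "fourier_symbol F d S z k (v j) =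
      (\<lambda>f. exp (- (\<i> * of_real (wave_dot d k (h j) + \<theta> j))) * v j f)" if "j \<in> ?J" for k j
  proof -
    have "S \<subseteq> ?F \<times> carrier Z" using walk by (simp add: scalar_quantum_walk_def)
    then have "fourier_symbol F d S z k (v j) = (\<lambda>a. (\<Sum>p\<in>S. z p * ?\<chi> (\<beta> j) (fst p) *
        exp (- (\<i> * of_real (wave_dot d k (snd p))))) * v j a)"
      by (rule fourier_symbol_character) (fact v_ell2 character)+
    \<comment> \<open>Evaluating the point mass on the plane wave produces the phase linear in
      \<open>k\<close>, with the same \<open>h j\<close> and \<open>\<theta> j\<close> as for the
      walk.\<close>
    then show ?thesis
      using shift[OF that, of "\<lambda>x. exp (- (\<i> * of_real (wave_dot d k x)))"]
      by (simp add: algebra_simps flip: exp_add)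
  qed
  have eigenvalues: "{\<mu>. eigenvalue_on_ell2 ?F (fourier_symbol F d S z k) \<mu>} =
      (\<lambda>j. exp (- (\<i> * of_real (wave_dot d k (h j) + \<theta> j)))) ` ?J" for k
    by (rule eigenvalues_of_eigenbasis[OF fin _ basis linear_on_ell2_fourier_symbol symbol]) auto
  show ?thesis
    using order basis hZ A_decomposed direct_sum A_tensor eigenvalues symbol by blast
qed

end
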